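(* Let $F:\mathbb{R}^n\to\mathbb{R}$ be a $\mu$-strongly convex function ($\mu>0$) with minimizer $\mathbf{x}^*$. Let $\tau\ge1$ be an integer, let $\xi_1,\dots,\xi_\tau\in\mathbb{R}$ satisfy $\sum_{i=1}^\tau\xi_i=1$ (the $\xi_i$ may be negative), and let $\beta>0$ satisfy $$\beta\ge\frac{\sum_{i=1}^\tau|\xi_i|-1}{\mu}.$$ Given arbitrary initial points $\mathbf{x}^{(0)},\dots,\mathbf{x}^{(\tau-1)}\in\mathbb{R}^n$, define for $k\ge\tau-1$ $$\mathbf{x}^{(k+1)}=\mathbf{prox}_{\beta F}(\tilde{\mathbf{x}}^{(k)}),\qquad\tilde{\mathbf{x}}^{(k)}=\sum_{i=1}^{\tau}\xi_i\,\mathbf{x}^{(k-\tau+i)}.$$ Then the iterates converge linearly, in the sense that for all $k\ge0$, $$\|\mathbf{x}^{(k+1)}-\mathbf{x}^*\|\le\left(\frac{\sum_{i=1}^\tau|\xi_i|}{1+\beta\mu}\right)^{\lfloor (k+1)/\tau\rfloor}\max_{j\in\{0,1,\dots,\tau-1\}}\|\mathbf{x}^{(j)}-\mathbf{x}^*\|.$$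
   Context: All norms are Euclidean norms. $\mathbf{prox}_{\beta F}(\mathbf{x})=\operatorname{argmin}_{\mathbf{z}}F(\mathbf{z})+\frac{1}{2\beta}\|\mathbf{x}-\mathbf{z}\|^2$. $F$ is $\mu$-strongly convex if $\mu>0$ and $F(\mathbf{y})\ge F(\mathbf{x})+\langle\zeta,\mathbf{y}-\mathbf{x}\rangle+\frac{\mu}{2}\|\mathbf{y}-\mathbf{x}\|^2$ for all $\mathbf{x},\mathbf{y}$ and all subgradients $\zeta\in\partial F(\mathbf{x})$ ($F$ is not assumed differentiable; equivalently $F-\frac{\mu}{2}\|\cdot\|^2$ is convex). *)

theory Defs
  imports "HOL-Analysis.Analysis"
begin

definition subdifferential :: "('a::real_inner \<Rightarrow> real) \<Rightarrow> 'a \<Rightarrow> 'a set" where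
  "subdifferential F x = {\<zeta>. \<forall>y. F y \<ge> F x + \<zeta> \<bullet> (y - x)}"

(* Convexity is a separate conjunct: a nonconvex F may have few or no subgradients, and the
   subgradient inequality alone would then hold vacuously.  With it, the definition says that
   F - (mu/2) |.|^2 is convex (for F on a Euclidean space). *)
definition strongly_convex :: "real \<Rightarrow> ('a::real_inner \<Rightarrow> real) \<Rightarrow> bool" where
  "strongly_convex \<mu> F \<longleftrightarrow> \<mu> > 0 \<and> convex_on UNIV F \<and>
     (\<forall>x y. \<forall>\<zeta>\<in>subdifferential F x.
        F y \<ge> F x + \<zeta> \<bullet> (y - x) + \<mu> / 2 * (norm (y - x))\<^sup>2)"

(* A choice operator: the value is unspecified if the objective has no minimizer. *)
definition prox :: "real \<Rightarrow> ('a::real_inner \<Rightarrow> real) \<Rightarrow> 'a \<Rightarrow> 'a" where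
  "prox \<beta> F x = arg_min (\<lambda>z. F z + 1 / (2 * \<beta>) * (norm (x - z))\<^sup>2) (\<lambda>_. True)"

end

theory Submission
  imports Defs
begin

text \<open>
  Each proximal step contracts distances to the minimizer by the factor \<open>1 / (1 + \<beta>\<mu>)\<close>: if
  \<open>z\<close> is the proximal point of \<open>y\<close>, then \<open>(y - z) / \<beta>\<close> is a subgradient of \<open>F\<close> at \<open>z\<close>, while
  \<open>0\<close> is a subgradient at the minimizer \<open>x*\<close>; adding the two strong convexity inequalities
  between \<open>z\<close> and \<open>x*\<close> gives \<open>(1 + \<beta>\<mu>) |z - x*|\<^sup>2 \<le> (y - x*) \<bullet> (z - x*)\<close>, and Cauchy-Schwarz
  finishes the argument (\<open>norm_prox_minus_minimizer_le\<close>).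

  Since the weights \<open>\<xi>\<close> sum to one, \<open>y - x*\<close> is the same combination of the previous \<open>\<tau>\<close>
  errors when \<open>y\<close> is the extrapolated point, so its norm is at most \<open>\<Sum>|\<xi>|\<close> times the
  largest of these errors. Hence every error is at most \<open>q = \<Sum>|\<xi>| / (1 + \<beta>\<mu>)\<close> times the
  maximum of the \<open>\<tau>\<close> errors before it. The bound on \<open>\<beta>\<close> says exactly that \<open>q \<le> 1\<close>, and then
  such a delayed recursion decays by a factor \<open>q\<close> in every block of \<open>\<tau>\<close> steps
  (\<open>delayed_contraction_decay\<close>).
\<close>

text \<open>
  Existence of the proximal point. The objective is continuous because a convex function on a
  Euclidean space is, and outside the ball around \<open>y\<close> whose squared radius is \<open>2\<beta> (F y - F m)\<close>
  it exceeds its value at \<open>y\<close>; so a minimum over that ball is global.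
\<close>

lemma is_arg_min_prox:
  fixes F :: "'a::euclidean_space \<Rightarrow> real"
  assumes "convex_on UNIV F" "\<And>z. F m \<le> F z" "\<beta> > 0"
  shows "is_arg_min (\<lambda>z. F z + 1 / (2 * \<beta>) * (norm (y - z))\<^sup>2) (\<lambda>_. True) (prox \<beta> F y)"
proof -
  let ?G = "\<lambda>z. F z + 1 / (2 * \<beta>) * (norm (y - z))\<^sup>2"
  define r where "r = sqrt (2 * \<beta> * (F y - F m))"
  have r0: "r \<ge> 0" and r2: "r\<^sup>2 = 2 * \<beta> * (F y - F m)"
    using assms by (auto simp: r_def)
  have "continuous_on UNIV F"
    using assms(1) by (intro convex_on_continuous) auto
  then have "continuous_on (cball y r) ?G"
    by (intro continuous_intros) (auto intro: continuous_on_subset)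
  moreover have "y \<in> cball y r" using r0 by simp
  ultimately obtain z where z: "z \<in> cball y r" "\<And>w. w \<in> cball y r \<Longrightarrow> ?G z \<le> ?G w"
    using continuous_attains_inf[of "cball y r" ?G] by auto
  have "?G z \<le> ?G w" for w
  proof (cases "w \<in> cball y r")
    case True
    then show ?thesis by (rule z(2))
  next
    case False
    then have "r < norm (y - w)" by (simp add: dist_norm)
    then have "r\<^sup>2 < (norm (y - w))\<^sup>2"
      using r0 by (intro power_strict_mono) auto
    then have "F y - F m \<le> 1 / (2 * \<beta>) * (norm (y - w))\<^sup>2"
      using \<open>\<beta> > 0\<close> unfolding r2 by (simp add: field_simps)
    moreover have "?G z \<le> ?G y" using \<open>y \<in> cball y r\<close> by (rule z(2))
    ultimately show ?thesis using assms(2)[of w] by simp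
  qed
  then have "is_arg_min ?G (\<lambda>_. True) z"
    by (auto simp: is_arg_min_def not_less)
  then show ?thesis
    unfolding prox_def arg_min_def by (rule someI)
qed

text \<open>
  The optimality condition of the proximal problem, obtained by comparing the objective at \<open>z\<close>
  with its value at \<open>z + t (w - z)\<close> and letting \<open>t\<close> tend to \<open>0\<close>.
\<close>

lemma prox_objective_minimizer_subgradient:
  fixes F :: "'a::real_inner \<Rightarrow> real"
  assumes "convex_on UNIV F" "\<beta> > 0"
    and "is_arg_min (\<lambda>z. F z + 1 / (2 * \<beta>) * (norm (y - z))\<^sup>2) (\<lambda>_. True) z"
  shows "(1 / \<beta>) *\<^sub>R (y - z) \<in> subdifferential F z"
proof -
  have "F z + (1 / \<beta>) * ((y - z) \<bullet> (w - z)) \<le> F w" for w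
  proof -
    let ?B = "(1 / \<beta>) * ((y - z) \<bullet> (w - z))" and ?c = "1 / (2 * \<beta>) * (norm (w - z))\<^sup>2"
    have step: "F z + (?B - t * ?c) \<le> F w" if t: "0 < t" "t < 1" for t
    proof -
      let ?p = "(1 - t) *\<^sub>R z + t *\<^sub>R w"
      have p: "y - ?p = (y - z) - t *\<^sub>R (w - z)"
        by (simp add: algebra_simps)
      have "(norm (y - ?p))\<^sup>2 = (norm (y - z))\<^sup>2 - 2 * t * ((y - z) \<bullet> (w - z)) + t\<^sup>2 * (norm (w - z))\<^sup>2"
        unfolding p power2_norm_eq_inner
        by (simp add: inner_diff_left inner_diff_right inner_commute algebra_simps power2_eq_square)
      then have "1 / (2 * \<beta>) * (norm (y - ?p))\<^sup>2
          = 1 / (2 * \<beta>) * (norm (y - z))\<^sup>2 - t * (?B - t * ?c)"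
        using \<open>\<beta> > 0\<close> by (simp add: field_simps power2_eq_square)
      moreover have "F z + 1 / (2 * \<beta>) * (norm (y - z))\<^sup>2 \<le> F ?p + 1 / (2 * \<beta>) * (norm (y - ?p))\<^sup>2"
        using assms(3) unfolding is_arg_min_def not_less[symmetric] by blast
      moreover have "F ?p \<le> (1 - t) * F z + t * F w"
        using convex_onD[OF assms(1), of t z w] t by simp
      ultimately have "t * (F z + (?B - t * ?c)) \<le> t * F w"
        by (simp add: algebra_simps)
      then show ?thesis using t by simp
    qed
    have "((\<lambda>t. F z + (?B - t * ?c)) \<longlongrightarrow> F z + (?B - 0 * ?c)) (at_right 0)"
      by (intro tendsto_intros)
    moreover have "eventually (\<lambda>t. F z + (?B - t * ?c) \<le> F w) (at_right 0)"
      using step unfolding eventually_at_right_field by (intro exI[of _ 1]) auto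
    ultimately have "F z + (?B - 0 * ?c) \<le> F w"
      by (rule tendsto_upperbound) simp
    then show ?thesis by simp
  qed
  then show ?thesis by (simp add: subdifferential_def)
qed

lemma norm_prox_minus_minimizer_le:
  fixes F :: "'a::euclidean_space \<Rightarrow> real"
  assumes sc: "strongly_convex \<mu> F" and min: "is_arg_min F (\<lambda>_. True) m" and "\<beta> > 0"
  shows "norm (prox \<beta> F y - m) \<le> norm (y - m) / (1 + \<beta> * \<mu>)"
proof -
  define z where "z = prox \<beta> F y"
  define d where "d = norm (z - m)"
  have \<mu>: "\<mu> > 0" and cvx: "convex_on UNIV F"
    using sc by (auto simp: strongly_convex_def)
  have strong: "F w \<ge> F v + \<zeta> \<bullet> (w - v) + \<mu> / 2 * (norm (w - v))\<^sup>2"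
    if "\<zeta> \<in> subdifferential F v" for v w \<zeta>
    using sc that by (auto simp: strongly_convex_def)
  have min': "F m \<le> F w" for w
    using min by (auto simp: is_arg_min_def not_less)
  then have "0 \<in> subdifferential F m"
    by (simp add: subdifferential_def)
  from strong[OF this, of z] have "F z \<ge> F m + \<mu> / 2 * d\<^sup>2"
    by (simp add: d_def)
  moreover have "(1 / \<beta>) *\<^sub>R (y - z) \<in> subdifferential F z"
    unfolding z_def
    by (intro prox_objective_minimizer_subgradient is_arg_min_prox[OF cvx min'] cvx assms)
  from strong[OF this, of m] have "F m \<ge> F z + (1 / \<beta>) * ((y - z) \<bullet> (m - z)) + \<mu> / 2 * d\<^sup>2"
    by (simp add: d_def norm_minus_commute)
  ultimately have "(1 / \<beta>) * ((y - z) \<bullet> (m - z)) + \<mu> * d\<^sup>2 \<le> 0" by simp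
  then have "(y - z) \<bullet> (m - z) + \<beta> * \<mu> * d\<^sup>2 \<le> 0"
    using \<open>\<beta> > 0\<close> by (simp add: field_simps)
  moreover have "(y - z) \<bullet> (m - z) = d\<^sup>2 - (y - m) \<bullet> (z - m)"
    unfolding d_def power2_norm_eq_inner
    by (simp add: inner_diff_left inner_diff_right inner_commute)
  moreover have "(y - m) \<bullet> (z - m) \<le> norm (y - m) * d"
    unfolding d_def by (rule norm_cauchy_schwarz)
  ultimately have "((1 + \<beta> * \<mu>) * d) * d \<le> norm (y - m) * d"
    by (simp add: algebra_simps power2_eq_square)
  then have "(1 + \<beta> * \<mu>) * d \<le> norm (y - m)"
    by (cases "d = 0") (auto simp: d_def)
  moreover have "1 + \<beta> * \<mu> > 0"
    using \<mu> \<open>\<beta> > 0\<close> by (simp add: add_pos_pos)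
  ultimately show ?thesis
    by (simp add: pos_le_divide_eq mult.commute d_def z_def)
qed

lemma norm_affine_combination_minus_le:
  fixes x :: "'i \<Rightarrow> 'a::real_normed_vector"
  assumes "(\<Sum>i\<in>I. \<xi> i) = 1" "\<And>i. i \<in> I \<Longrightarrow> norm (x i - m) \<le> C"
  shows "norm ((\<Sum>i\<in>I. \<xi> i *\<^sub>R x i) - m) \<le> (\<Sum>i\<in>I. \<bar>\<xi> i\<bar>) * C"
proof -
  have "(\<Sum>i\<in>I. \<xi> i *\<^sub>R x i) - m = (\<Sum>i\<in>I. \<xi> i *\<^sub>R x i) - (\<Sum>i\<in>I. \<xi> i) *\<^sub>R m"
    using assms(1) by simp
  also have "\<dots> = (\<Sum>i\<in>I. \<xi> i *\<^sub>R (x i - m))"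
    by (simp add: scaleR_sum_left sum_subtractf scaleR_diff_right)
  also have "norm \<dots> \<le> (\<Sum>i\<in>I. \<bar>\<xi> i\<bar> * C)"
    by (rule sum_norm_le) (simp add: assms(2) mult_left_mono)
  finally show ?thesis by (simp add: sum_distrib_right)
qed

text \<open>
  The hypothesis \<open>step\<close> states that \<open>e n\<close> is at most \<open>q\<close> times the maximum of the preceding \<open>\<tau>\<close>
  values, with the maximum expressed through its upper bounds. The \<open>\<tau>\<close> values preceding \<open>e n\<close>
  have index at least \<open>n - \<tau>\<close>, so that each has passed at least \<open>n div \<tau> - 1\<close> complete blocks.
\<close>

lemma delayed_contraction_decay:
  fixes e :: "nat \<Rightarrow> real"
  assumes "\<tau> \<ge> 1" "0 \<le> q" "q \<le> 1" "0 \<le> M"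
    and init: "\<And>j. j < \<tau> \<Longrightarrow> e j \<le> M"
    and step: "\<And>n C. \<tau> \<le> n \<Longrightarrow> (\<And>j. n - \<tau> \<le> j \<Longrightarrow> j < n \<Longrightarrow> e j \<le> C) \<Longrightarrow> e n \<le> q * C"
  shows "e n \<le> q ^ (n div \<tau>) * M"
proof (induction n rule: less_induct)
  case (less n)
  show ?case
  proof (cases "n < \<tau>")
    case True
    then show ?thesis using init by simp
  next
    case False
    then have n: "\<tau> \<le> n" by simp
    have div_n: "n div \<tau> = Suc ((n - \<tau>) div \<tau>)"
      using n \<open>\<tau> \<ge> 1\<close> by (simp add: le_div_geq)
    have "e n \<le> q * (q ^ ((n - \<tau>) div \<tau>) * M)"
    proof (rule step[OF n])
      fix j assume j: "n - \<tau> \<le> j" "j < n"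
      have "e j \<le> q ^ (j div \<tau>) * M" using j by (intro less.IH)
      also have "\<dots> \<le> q ^ ((n - \<tau>) div \<tau>) * M"
        using j assms by (intro mult_right_mono power_decreasing div_le_mono) auto
      finally show "e j \<le> q ^ ((n - \<tau>) div \<tau>) * M" .
    qed
    then show ?thesis by (simp add: div_n mult.assoc)
  qed
qed

theorem theorem5p4:
  fixes F :: "real ^ 'n \<Rightarrow> real"
    and xstar :: "real ^ 'n"
    and x xtilde :: "nat \<Rightarrow> real ^ 'n"
    and \<xi> :: "nat \<Rightarrow> real"
    and \<mu> \<beta> :: real
    and \<tau> :: nat
  assumes "\<mu> > 0"
    and "strongly_convex \<mu> F"
    and "is_arg_min F (\<lambda>_. True) xstar"
    and "\<tau> \<ge> 1"
    and "(\<Sum>i=1..\<tau>. \<xi> i) = 1"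
    and "\<beta> > 0"
    and "\<beta> \<ge> ((\<Sum>i=1..\<tau>. \<bar>\<xi> i\<bar>) - 1) / \<mu>"
    and "\<And>k. k \<ge> \<tau> - 1 \<Longrightarrow> xtilde k = (\<Sum>i=1..\<tau>. \<xi> i *\<^sub>R x (k + i - \<tau>))"
    and "\<And>k. k \<ge> \<tau> - 1 \<Longrightarrow> x (k + 1) = prox \<beta> F (xtilde k)"
  shows "\<forall>k. norm (x (k + 1) - xstar)
    \<le> ((\<Sum>i=1..\<tau>. \<bar>\<xi> i\<bar>) / (1 + \<beta> * \<mu>)) ^ ((k + 1) div \<tau>)
        * (MAX j\<in>{0..\<tau> - 1}. norm (x j - xstar))"
proof
  fix k
  let ?S = "\<Sum>i=1..\<tau>. \<bar>\<xi> i\<bar>"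
  let ?M = "MAX j\<in>{0..\<tau> - 1}. norm (x j - xstar)"
  have pos: "1 + \<beta> * \<mu> > 0"
    using assms(1,6) by (simp add: add_pos_pos)
  have init: "norm (x j - xstar) \<le> ?M" if "j < \<tau>" for j
    using that by (intro Max_ge) auto
  have M: "0 \<le> ?M"
    using init[of 0] \<open>\<tau> \<ge> 1\<close> norm_ge_zero[of "x 0 - xstar"] by linarith
  have S0: "0 \<le> ?S" by (simp add: sum_nonneg)
  have "?S \<le> 1 + \<beta> * \<mu>"
    using assms(1,7) by (simp add: pos_divide_le_eq algebra_simps)
  then have q1: "?S / (1 + \<beta> * \<mu>) \<le> 1"
    using pos by (simp add: pos_divide_le_eq)
  have q0: "0 \<le> ?S / (1 + \<beta> * \<mu>)" using S0 pos by simp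
  have step: "norm (x n - xstar) \<le> ?S / (1 + \<beta> * \<mu>) * C"
    if n: "\<tau> \<le> n" and C: "\<And>j. n - \<tau> \<le> j \<Longrightarrow> j < n \<Longrightarrow> norm (x j - xstar) \<le> C" for n C
  proof -
    have n1: "\<tau> - 1 \<le> n - 1" "n - 1 + 1 = n" using n \<open>\<tau> \<ge> 1\<close> by auto
    have "norm (x n - xstar) \<le> norm (xtilde (n - 1) - xstar) / (1 + \<beta> * \<mu>)"
      unfolding assms(9)[OF n1(1), unfolded n1(2)]
      by (rule norm_prox_minus_minimizer_le[OF assms(2,3,6)])
    also have "norm (xtilde (n - 1) - xstar) \<le> ?S * C"
      unfolding assms(8)[OF n1(1)]
    proof (rule norm_affine_combination_minus_le[OF assms(5)])
      fix i assume "i \<in> {1..\<tau>}"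
      then show "norm (x (n - 1 + i - \<tau>) - xstar) \<le> C"
        using n by (intro C) auto
    qed
    finally show ?thesis
      using pos by (simp add: divide_right_mono)
  qed
  show "norm (x (k + 1) - xstar) \<le> (?S / (1 + \<beta> * \<mu>)) ^ ((k + 1) div \<tau>) * ?M"
    using delayed_contraction_decay[where e = "\<lambda>n. norm (x n - xstar)", OF \<open>\<tau> \<ge> 1\<close> q0 q1 M init step]
    by blast
qed

end
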